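(* For every integer $k\ge 1$, $|I_k(132,321)|$ is equal to the number of partitions of $k$ in which all parts are equal, and this is in turn equal to the number of positive divisors of $k$.
   Context: A permutation of length $n$ is a word $\pi=\pi_1\cdots\pi_n$ containing each of $1,\dots,n$ exactly once. The sum of permutations $\rho=\rho_1\cdots\rho_n$ and $\tau=\tau_1\cdots\tau_m$ is the permutation $\rho\oplus\tau=\rho_1\cdots\rho_n(n+\tau_1)\cdots(n+\tau_m)$ of length $n+m$. A permutation is decomposable if it equals $\rho\oplus\tau$ for some non-empty permutations $\rho,\tau$; a non-empty permutation that is not decomposable is indecomposable. An inversion of $\pi$ is a pair $(i,j)$ with $i<j$ and $\pi_i>\pi_j$. A permutation $\pi$ contains a permutation (pattern) $\tau=\tau_1\cdots\tau_m$ if there are indices $i_1<\dots<i_m$ such that $\pi_{i_1},\dots,\pi_{i_m}$ is order-isomorphic to $\tau_1,\dots,\tau_m$; otherwise $\pi$ avoids $\tau$. $I_k(\tau_1,\dots,\tau_r)$ denotes the (finite) set of all indecomposable permutations, of any length, with exactly $k$ inversions that avoid all of $\tau_1,\dots,\tau_r$. *)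

theory Defs
  imports "HOL-Combinatorics.Multiset_Permutations"
begin

text \<open>
  A permutation of length \<open>n\<close> is represented by the list of its values, which are the numbers
  \<open>1, \<dots>, n\<close>. Positions are list indices and thus run from \<open>0\<close> to \<open>n - 1\<close>.
\<close>

definition is_perm :: "nat list \<Rightarrow> bool" where
  "is_perm \<pi> \<longleftrightarrow> \<pi> \<in> permutations_of_set {1..length \<pi>}"

definition perm_sum :: "nat list \<Rightarrow> nat list \<Rightarrow> nat list" where
  "perm_sum \<rho> \<tau> = \<rho> @ map (\<lambda>t. length \<rho> + t) \<tau>"

definition decomposable :: "nat list \<Rightarrow> bool" where
  "decomposable \<pi> \<longleftrightarrow>
     (\<exists>\<rho> \<tau>. is_perm \<rho> \<and> is_perm \<tau> \<and> \<rho> \<noteq> [] \<and> \<tau> \<noteq> [] \<and> \<pi> = perm_sum \<rho> \<tau>)"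

definition indecomposable :: "nat list \<Rightarrow> bool" where
  "indecomposable \<pi> \<longleftrightarrow> is_perm \<pi> \<and> \<pi> \<noteq> [] \<and> \<not> decomposable \<pi>"

definition inversions :: "nat list \<Rightarrow> (nat \<times> nat) set" where
  "inversions \<pi> = {(i, j). i < j \<and> j < length \<pi> \<and> \<pi> ! i > \<pi> ! j}"

definition order_isomorphic :: "nat list \<Rightarrow> nat list \<Rightarrow> bool" where
  "order_isomorphic xs ys \<longleftrightarrow> length xs = length ys \<and>
     (\<forall>i<length xs. \<forall>j<length xs. xs ! i < xs ! j \<longleftrightarrow> ys ! i < ys ! j)"

definition contains_pattern :: "nat list \<Rightarrow> nat list \<Rightarrow> bool" where
  "contains_pattern \<pi> \<tau> \<longleftrightarrow>
     (\<exists>idx. sorted_wrt (<) idx \<and> set idx \<subseteq> {..<length \<pi>} \<and>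
            order_isomorphic (map (\<lambda>i. \<pi> ! i) idx) \<tau>)"

definition avoids :: "nat list \<Rightarrow> nat list \<Rightarrow> bool" where
  "avoids \<pi> \<tau> \<longleftrightarrow> \<not> contains_pattern \<pi> \<tau>"

definition indec_avoiders :: "nat \<Rightarrow> nat list set \<Rightarrow> nat list set" where
  "indec_avoiders k T =
     {\<pi>. indecomposable \<pi> \<and> card (inversions \<pi>) = k \<and> (\<forall>\<tau>\<in>T. avoids \<pi> \<tau>)}"

text \<open>A partition of a natural number is the multiset of its parts.\<close>

definition is_partition_of :: "nat multiset \<Rightarrow> nat \<Rightarrow> bool" where
  "is_partition_of P k \<longleftrightarrow> (\<forall>p\<in>#P. p > 0) \<and> sum_mset P = k"

end

theory Submission
  imports Defs
begin

text \<open>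
  Let \<open>\<pi>\<close> be an indecomposable permutation of length \<open>n\<close> with at least one inversion that avoids
  \<open>132\<close> and \<open>321\<close>, and write \<open>\<pi> = xs n ys\<close>. The word \<open>ys\<close> is non-empty, since otherwise
  \<open>\<pi> = xs \<oplus> 1\<close>, where \<open>xs\<close> is non-empty because \<open>\<pi>\<close> has an inversion. Avoiding \<open>132\<close> forces every entry of \<open>xs\<close> to exceed every entry of \<open>ys\<close>. Avoiding
  \<open>321\<close> then makes both \<open>xs\<close> and \<open>ys\<close> increasing: a descent in \<open>xs\<close> could be completed by any entry
  of \<open>ys\<close>, and a descent in \<open>ys\<close> by the entry \<open>n\<close>. Hence \<open>\<pi>\<close> is the rotated identity
  \<open>(b+1) \<cdots> (b+a) 1 \<cdots> b\<close> with \<open>a, b \<ge> 1\<close> (lemma \<open>indec_avoider_eq_rotated\<close>).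

  Conversely, every such word has these properties, and it has exactly \<open>a * b\<close> inversions. The
  permutations counted are therefore parametrised by the divisors \<open>b\<close> of \<open>k\<close>, with \<open>a = k div b\<close>.
  A partition of \<open>k\<close> with equal parts is likewise determined by its part \<open>d\<close>, which divides \<open>k\<close>.
\<close>

section \<open>Patterns of length three\<close>

lemma contains_pattern_3:
  "contains_pattern \<pi> [p, q, r] \<longleftrightarrow>
     (\<exists>i j l. i < j \<and> j < l \<and> l < length \<pi> \<and> order_isomorphic [\<pi> ! i, \<pi> ! j, \<pi> ! l] [p, q, r])"
    (is "?L \<longleftrightarrow> ?R")
proof
  assume ?L
  then obtain idx where idx: "sorted_wrt (<) idx" "set idx \<subseteq> {..<length \<pi>}"
    "order_isomorphic (map (\<lambda>i. \<pi> ! i) idx) [p, q, r]"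
    by (auto simp: contains_pattern_def)
  then have "length idx = 3"
    by (simp add: order_isomorphic_def)
  then obtain i j l where "idx = [i, j, l]"
    by (auto simp: length_Suc_conv eval_nat_numeral)
  with idx show ?R
    by auto
next
  assume ?R
  then obtain i j l where "i < j" "j < l" "l < length \<pi>"
    "order_isomorphic [\<pi> ! i, \<pi> ! j, \<pi> ! l] [p, q, r]"
    by blast
  then show ?L
    unfolding contains_pattern_def by (intro exI[of _ "[i, j, l]"]) auto
qed

lemma order_isomorphic_132: "order_isomorphic [x, y, z] [1, 3, 2] \<longleftrightarrow> x < z \<and> z < y"
  by (auto simp: order_isomorphic_def All_less_Suc numeral_3_eq_3 numeral_2_eq_2)

lemma order_isomorphic_321: "order_isomorphic [x, y, z] [3, 2, 1] \<longleftrightarrow> z < y \<and> y < x"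
  by (auto simp: order_isomorphic_def All_less_Suc numeral_3_eq_3 numeral_2_eq_2)

lemma avoids_132_iff:
  "avoids \<pi> [1, 3, 2] \<longleftrightarrow>
     (\<forall>i j l. i < j \<and> j < l \<and> l < length \<pi> \<longrightarrow> \<not> (\<pi> ! i < \<pi> ! l \<and> \<pi> ! l < \<pi> ! j))"
  unfolding avoids_def contains_pattern_3 order_isomorphic_132 by blast

lemma avoids_321_iff:
  "avoids \<pi> [3, 2, 1] \<longleftrightarrow>
     (\<forall>i j l. i < j \<and> j < l \<and> l < length \<pi> \<longrightarrow> \<not> (\<pi> ! l < \<pi> ! j \<and> \<pi> ! j < \<pi> ! i))"
  unfolding avoids_def contains_pattern_3 order_isomorphic_321 by blast

section \<open>Rotated identities\<close>

text \<open>The permutation \<open>(b+1) \<cdots> (b+a) 1 \<cdots> b\<close> of length \<open>a + b\<close>.\<close>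

definition rotated :: "nat \<Rightarrow> nat \<Rightarrow> nat list" where
  "rotated a b = [Suc b..<Suc (b + a)] @ [1..<Suc b]"

lemma length_rotated [simp]: "length (rotated a b) = a + b"
  by (simp add: rotated_def)

lemma nth_rotated:
  "i < a + b \<Longrightarrow> rotated a b ! i = (if i < a then Suc (b + i) else Suc (i - a))"
  by (auto simp: rotated_def nth_append simp del: upt_Suc)

lemma is_perm_rotated: "is_perm (rotated a b)"
proof -
  have "set (rotated a b) = {1..a + b}" "distinct (rotated a b)"
    by (auto simp: rotated_def simp del: upt_Suc)
  then show ?thesis
    by (simp add: is_perm_def permutations_of_set_def)
qed

lemma inversions_rotated: "inversions (rotated a b) = {..<a} \<times> {a..<a + b}"
  by (auto simp: inversions_def nth_rotated split: if_splits)

lemma avoids_132_rotated: "avoids (rotated a b) [1, 3, 2]"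
  unfolding avoids_132_iff by (auto simp: nth_rotated)

lemma avoids_321_rotated: "avoids (rotated a b) [3, 2, 1]"
  unfolding avoids_321_iff by (auto simp: nth_rotated)

lemma decomposable_hd_less_last:
  assumes "decomposable \<pi>"
  shows "hd \<pi> < last \<pi>"
proof -
  from assms obtain \<rho> \<tau> where *: "is_perm \<rho>" "is_perm \<tau>" "\<rho> \<noteq> []" "\<tau> \<noteq> []" "\<pi> = perm_sum \<rho> \<tau>"
    by (auto simp: decomposable_def)
  have "hd \<rho> \<in> {1..length \<rho>}" "last \<tau> \<in> {1..length \<tau>}"
    using *(1-4) hd_in_set[of \<rho>] last_in_set[of \<tau>]
    by (simp_all add: is_perm_def permutations_of_set_def)
  with * show ?thesis
    by (simp add: perm_sum_def last_map)
qed

lemma indecomposable_rotated: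
  assumes "a > 0" "b > 0"
  shows "indecomposable (rotated a b)"
proof -
  have "rotated a b \<noteq> []"
    using assms by (simp flip: length_greater_0_conv)
  moreover from this have "hd (rotated a b) = Suc b" "last (rotated a b) = b"
    using assms by (simp_all add: hd_conv_nth last_conv_nth nth_rotated)
  ultimately show ?thesis
    using is_perm_rotated decomposable_hd_less_last[of "rotated a b"]
    by (auto simp: indecomposable_def)
qed

lemma rotated_in_indec_avoiders:
  assumes "a > 0" "b > 0"
  shows "rotated a b \<in> indec_avoiders (a * b) {[1, 3, 2], [3, 2, 1]}"
  using indecomposable_rotated[OF assms] avoids_132_rotated avoids_321_rotated
  by (simp add: indec_avoiders_def inversions_rotated)

section \<open>Classification of the avoiders\<close>

lemma decomposable_append_max:
  assumes "is_perm (xs @ [Suc (length xs)])" "xs \<noteq> []"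
  shows "decomposable (xs @ [Suc (length xs)])"
proof -
  have "insert (Suc (length xs)) (set xs) = {1..Suc (length xs)}" "distinct xs"
    "Suc (length xs) \<notin> set xs"
    using assms(1) by (simp_all add: is_perm_def permutations_of_set_def)
  then have "set xs = {1..Suc (length xs)} - {Suc (length xs)}"
    by blast
  also have "\<dots> = {1..length xs}"
    by auto
  finally have "is_perm xs"
    using \<open>distinct xs\<close> by (simp add: is_perm_def permutations_of_set_def)
  moreover have "is_perm [1]"
    by (simp add: is_perm_def permutations_of_set_def)
  ultimately show ?thesis
    using assms(2) unfolding decomposable_def
    by (intro exI[of _ xs] exI[of _ "[1]"]) (simp add: perm_sum_def)
qed

lemma is_perm_append_sorted:
  assumes "is_perm (us @ vs)" "sorted us" "sorted vs" "\<And>u v. u \<in> set us \<Longrightarrow> v \<in> set vs \<Longrightarrow> v < u"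
  shows "us @ vs = rotated (length us) (length vs)"
proof -
  let ?n = "length us + length vs"
  have "set (us @ vs) = {1..?n}" "distinct (us @ vs)"
    using assms(1) by (auto simp: is_perm_def permutations_of_set_def)
  \<comment> \<open>Exchanging the two blocks sorts the permutation.\<close>
  then have "set (vs @ us) = set [1..<Suc ?n]" "distinct (vs @ us)"
    by (simp_all add: Un_commute Int_commute atLeastLessThanSuc_atLeastAtMost del: upt_Suc)
  moreover have "sorted (vs @ us)"
    using assms(2-4) by (auto simp: sorted_append less_imp_le)
  ultimately have "vs @ us = [1..<Suc ?n]"
    by (intro sorted_distinct_set_unique) (simp_all del: upt_Suc)
  also have "\<dots> = [1..<Suc (length vs)] @ [Suc (length vs)..<Suc ?n]"
    using upt_add_eq_append[of 1 "Suc (length vs)" "length us"] by (simp add: add.commute)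
  finally show ?thesis
    by (simp add: rotated_def add.commute del: upt_Suc)
qed

lemma indec_avoider_eq_rotated:
  assumes "indecomposable \<pi>" "avoids \<pi> [1, 3, 2]" "avoids \<pi> [3, 2, 1]" "inversions \<pi> \<noteq> {}"
  obtains a b where "a > 0" "b > 0" "\<pi> = rotated a b"
proof -
  define n where "n = length \<pi>"
  have perm: "is_perm \<pi>" and ne: "\<pi> \<noteq> []"
    using assms(1) by (auto simp: indecomposable_def)
  then have set_\<pi>: "set \<pi> = {1..n}" and dist: "distinct \<pi>"
    by (auto simp: is_perm_def permutations_of_set_def n_def)
  have "n \<in> set \<pi>"
    using set_\<pi> ne by (simp add: n_def Suc_le_eq)
  then obtain xs ys where split: "\<pi> = xs @ n # ys"
    by (auto simp: in_set_conv_decomp)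
  have less_n: "x < n" if "x \<in> set xs \<union> set ys" for x
  proof -
    have "x \<le> n" using that set_\<pi> split by auto
    moreover have "x \<noteq> n" using that dist split by auto
    ultimately show ?thesis by simp
  qed
  have len_\<pi>: "length \<pi> = Suc (length xs + length ys)"
    by (simp add: split)
  have len: "n = Suc (length xs + length ys)"
    using len_\<pi> n_def by simp
  have "ys \<noteq> []"
  proof
    assume "ys = []"
    with len have "\<pi> = xs @ [Suc (length xs)]"
      by (simp add: split)
    moreover have "xs \<noteq> []"
      using calculation assms(4) by (auto simp: inversions_def)
    ultimately show False
      using decomposable_append_max[of xs] perm assms(1) by (simp add: indecomposable_def)
  qed
  have nth_n: "\<pi> ! length xs = n"
    by (simp add: split)
  have nth_xs: "\<pi> ! i = xs ! i" if "i < length xs" for i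
    using that by (simp add: split nth_append)
  have nth_ys: "\<pi> ! Suc (length xs + i) = ys ! i" for i
    by (simp add: split nth_append)
  have xs_gt_ys: "y < x" if "x \<in> set xs" "y \<in> set ys" for x y
  proof (rule ccontr)
    assume "\<not> y < x"
    moreover have "x \<noteq> y"
      using that dist split by auto
    ultimately have "x < y" by simp
    obtain i j where "i < length xs" "x = xs ! i" "j < length ys" "y = ys ! j"
      using \<open>x \<in> set xs\<close> \<open>y \<in> set ys\<close> by (auto simp: in_set_conv_nth)
    then show False
      using assms(2)[unfolded avoids_132_iff, rule_format,
          of i "length xs" "Suc (length xs + j)"] \<open>x < y\<close> less_n[of y] that
      by (simp add: nth_n nth_xs nth_ys len_\<pi>)
  qed
  have sorted_ys: "sorted ys"
    unfolding sorted_iff_nth_mono_less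
  proof (intro allI impI)
    fix i j assume ij: "i < j" "j < length ys"
    then show "ys ! i \<le> ys ! j"
      using assms(3)[unfolded avoids_321_iff, rule_format,
          of "length xs" "Suc (length xs + i)" "Suc (length xs + j)"] less_n[of "ys ! i"]
      by (simp add: nth_n nth_ys len_\<pi> not_less)
  qed
  have sorted_xs: "sorted xs"
    unfolding sorted_iff_nth_mono_less
  proof (intro allI impI)
    fix i j assume ij: "i < j" "j < length xs"
    then show "xs ! i \<le> xs ! j"
      using assms(3)[unfolded avoids_321_iff, rule_format, of i j "Suc (length xs + 0)"]
        xs_gt_ys[of "xs ! j" "ys ! 0"] \<open>ys \<noteq> []\<close> nth_ys[of 0]
      by (simp add: nth_xs len_\<pi> not_less)
  qed
  have "(xs @ [n]) @ ys = rotated (length (xs @ [n])) (length ys)"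
  proof (rule is_perm_append_sorted)
    show "is_perm ((xs @ [n]) @ ys)" using perm split by simp
    show "sorted (xs @ [n])" using sorted_xs less_n by (auto simp: sorted_append less_imp_le)
  qed (use sorted_ys xs_gt_ys less_n in auto)
  then have "\<pi> = rotated (length (xs @ [n])) (length ys)"
    using split by simp
  then show thesis
    by (rule that[rotated 2]) (use \<open>ys \<noteq> []\<close> in auto)
qed

section \<open>Bijections with the divisors\<close>

lemma bij_betw_divisors_indec_avoiders:
  assumes "k \<ge> 1"
  shows "bij_betw (\<lambda>d. rotated (k div d) d) {d. d > 0 \<and> d dvd k}
           (indec_avoiders k {[1, 3, 2], [3, 2, 1]})"
proof (rule bij_betw_imageI)
  have pos: "k div d > 0" if "d > 0" "d dvd k" for d
    using that assms by (simp add: div_greater_zero_iff dvd_imp_le)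
  show "inj_on (\<lambda>d. rotated (k div d) d) {d. d > 0 \<and> d dvd k}"
  proof (rule inj_on_inverseI)
    \<comment> \<open>The first entry is \<open>d + 1\<close>, from which \<open>d\<close> is recovered.\<close>
    fix d assume "d \<in> {d. d > 0 \<and> d dvd k}"
    then show "rotated (k div d) d ! 0 - 1 = d"
      using pos[of d] by (simp add: nth_rotated)
  qed
  show "(\<lambda>d. rotated (k div d) d) ` {d. d > 0 \<and> d dvd k} =
          indec_avoiders k {[1, 3, 2], [3, 2, 1]}"
  proof (intro equalityI subsetI)
    fix \<pi> assume "\<pi> \<in> (\<lambda>d. rotated (k div d) d) ` {d. d > 0 \<and> d dvd k}"
    then obtain d where "d > 0" "d dvd k" "\<pi> = rotated (k div d) d"
      by auto
    then show "\<pi> \<in> indec_avoiders k {[1, 3, 2], [3, 2, 1]}"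
      using rotated_in_indec_avoiders[of "k div d" d] pos[of d] by simp
  next
    fix \<pi> assume "\<pi> \<in> indec_avoiders k {[1, 3, 2], [3, 2, 1]}"
    then have \<pi>: "indecomposable \<pi>" "avoids \<pi> [1, 3, 2]" "avoids \<pi> [3, 2, 1]"
      and card: "card (inversions \<pi>) = k"
      by (auto simp: indec_avoiders_def)
    have "inversions \<pi> \<noteq> {}"
      using card assms by auto
    with \<pi> obtain a b where ab: "a > 0" "b > 0" "\<pi> = rotated a b"
      by (rule indec_avoider_eq_rotated)
    then have "k = a * b"
      using card by (simp add: inversions_rotated)
    with ab show "\<pi> \<in> (\<lambda>d. rotated (k div d) d) ` {d. d > 0 \<and> d dvd k}"
      by (intro image_eqI[of _ _ b]) auto
  qed
qed

lemma bij_betw_divisors_equal_part_partitions: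
  assumes "k \<ge> 1"
  shows "bij_betw (\<lambda>d. replicate_mset (k div d) d) {d. d > 0 \<and> d dvd k}
           {P. is_partition_of P k \<and> (\<forall>p\<in>#P. \<forall>q\<in>#P. p = q)}"
proof (rule bij_betw_imageI)
  have pos: "k div d > 0" if "d > 0" "d dvd k" for d
    using that assms by (simp add: div_greater_zero_iff dvd_imp_le)
  show "inj_on (\<lambda>d. replicate_mset (k div d) d) {d. d > 0 \<and> d dvd k}"
  proof (rule inj_on_inverseI)
    fix d assume "d \<in> {d. d > 0 \<and> d dvd k}"
    then show "the_elem (set_mset (replicate_mset (k div d) d)) = d"
      using pos[of d] by (simp add: set_mset_replicate_mset_subset)
  qed
  show "(\<lambda>d. replicate_mset (k div d) d) ` {d. d > 0 \<and> d dvd k} =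
          {P. is_partition_of P k \<and> (\<forall>p\<in>#P. \<forall>q\<in>#P. p = q)}"
  proof (intro equalityI subsetI)
    fix P assume "P \<in> (\<lambda>d. replicate_mset (k div d) d) ` {d. d > 0 \<and> d dvd k}"
    then obtain d where "d > 0" "d dvd k" "P = replicate_mset (k div d) d"
      by auto
    then show "P \<in> {P. is_partition_of P k \<and> (\<forall>p\<in>#P. \<forall>q\<in>#P. p = q)}"
      by (simp add: is_partition_of_def)
  next
    fix P assume "P \<in> {P. is_partition_of P k \<and> (\<forall>p\<in>#P. \<forall>q\<in>#P. p = q)}"
    then have P: "\<forall>p\<in>#P. p > 0" "sum_mset P = k" "\<forall>p\<in>#P. \<forall>q\<in>#P. p = q"
      unfolding is_partition_of_def by blast+
    have "P \<noteq> {#}"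
      using P(2) assms by auto
    then obtain d where d: "d \<in># P"
      by auto
    then have "set_mset P \<subseteq> {d}"
      using P(3) by blast
    then have "P = replicate_mset (size P) d"
      by (rule set_mset_subset_singletonD)
    then obtain m where rep: "P = replicate_mset m d"
      by (rule that)
    then have "k = m * d"
      using P(2) by simp
    moreover have "d > 0"
      using d P(1) by auto
    ultimately show "P \<in> (\<lambda>d. replicate_mset (k div d) d) ` {d. d > 0 \<and> d dvd k}"
      using rep by (intro image_eqI[of _ _ d]) auto
  qed
qed

theorem theorem19:
  fixes k :: nat
  assumes "k \<ge> 1"
  shows "card (indec_avoiders k {[1, 3, 2], [3, 2, 1]}) =
           card {P. is_partition_of P k \<and> (\<forall>p\<in>#P. \<forall>q\<in>#P. p = q)}
       \<and> card {P. is_partition_of P k \<and> (\<forall>p\<in>#P. \<forall>q\<in>#P. p = q)} =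
           card {d :: nat. d > 0 \<and> d dvd k}"
  using bij_betw_same_card[OF bij_betw_divisors_indec_avoiders[OF assms]]
    bij_betw_same_card[OF bij_betw_divisors_equal_part_partitions[OF assms]]
  by simp

end
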